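(* Let $I\subset\mathbb{R}$ be a compact nondegenerate interval and let $\mathcal{C}$ be the set of all contraction maps $I\to I$. There exists a universal function in the class $\mathcal{C}$; that is, there exists $f\in\mathcal{C}$ such that for every $g\in\mathcal{C}$ and every $y\in I$ there exists $x\in I$ for which $(f^n(x))_{n=0}^{\infty}$ and $(g^n(y))_{n=0}^{\infty}$ have the same order-pattern.
   Context: A map $f:I\to I$ is a contraction if there is a constant $0\le c<1$ with $|f(x)-f(y)|\le c|x-y|$ for all $x,y\in I$. Here $f^n$ denotes the $n$-th iterate of $f$, with $f^0$ the identity. Two real sequences $(a_n)_{n=0}^{\infty}$ and $(b_n)_{n=0}^{\infty}$ have the same order-pattern if, for all $m,n\ge 0$, $a_m<a_n\iff b_m<b_n$. *)

theory Defs
  imports "HOL-Analysis.Analysis"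
begin

text \<open>Self-maps of \<open>I\<close> are represented by total functions on the reals; their values
  outside \<open>I\<close> are irrelevant. The library predicate \<^const>\<open>lipschitz_on\<close> includes the
  requirement that the constant be nonnegative.\<close>

definition contraction_maps :: "real set \<Rightarrow> (real \<Rightarrow> real) set" where
  "contraction_maps I = {f. f \<in> I \<rightarrow> I \<and> (\<exists>c<1. c-lipschitz_on I f)}"

definition same_order_pattern :: "(nat \<Rightarrow> real) \<Rightarrow> (nat \<Rightarrow> real) \<Rightarrow> bool" where
  "same_order_pattern a b \<longleftrightarrow> (\<forall>m n. a m < a n \<longleftrightarrow> b m < b n)"

end

theory Submission
  imports Defs
begin

text \<open>
  The distances of an orbit of a contraction to the fixed point decrease strictly until they
  vanish. Hence the order-pattern of an orbit is determined by the signs of its terms relative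
  to the fixed point, and once such a sign is \<open>0\<close> all later ones are. It therefore suffices to
  find one contraction for which every such sign sequence is realised.

  With centre \<open>0\<close> and \<open>r\<^sub>n = h / 8 ^ n\<close>, take the supremum of tents of slope \<open>1/2\<close> placed at
  \<open>\<bar>x\<bar> = r\<^sub>n\<close>, which sends each of the two pieces \<open>r\<^sub>n / 2 \<le> \<bar>x\<bar> \<le> r\<^sub>n\<close> affinely onto
  \<open>{- r\<^sub>n\<^sub>+\<^sub>1..r\<^sub>n\<^sub>+\<^sub>1}\<close>. Inverting these branches along a sign sequence \<open>s\<close> gives the point
  \<open>r\<^sub>0 z\<^sub>0\<close> of the orbit \<open>r\<^sub>n z\<^sub>n\<close>, where \<open>z\<^sub>n = s\<^sub>n (3/4 + z\<^sub>n\<^sub>+\<^sub>1 / 4)\<close>.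
\<close>

text \<open>For each \<open>i\<close>, \<open>f i x\<close> exceeds the supremum at \<open>y\<close>
  by at most \<open>c * dist x y\<close>; take the supremum over \<open>i\<close>, then swap
  \<open>x\<close> and \<open>y\<close>.\<close>

lemma lipschitz_on_cSUP:
  fixes f :: "'i \<Rightarrow> real \<Rightarrow> real"
  assumes "I \<noteq> {}" and c: "0 \<le> c"
    and lip: "\<And>i. i \<in> I \<Longrightarrow> c-lipschitz_on S (f i)"
    and bdd: "\<And>x. x \<in> S \<Longrightarrow> bdd_above ((\<lambda>i. f i x) ` I)"
  shows "c-lipschitz_on S (\<lambda>x. SUP i\<in>I. f i x)"
proof (rule lipschitz_onI[OF _ c])
  have le: "(SUP i\<in>I. f i x) \<le> (SUP i\<in>I. f i y) + c * dist x y" if "x \<in> S" "y \<in> S" for x y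
  proof (rule cSUP_least[OF \<open>I \<noteq> {}\<close>])
    fix i assume i: "i \<in> I"
    have "f i x \<le> f i y + c * dist x y"
      using lipschitz_onD[OF lip[OF i] that] by (auto simp: dist_real_def)
    also have "f i y \<le> (SUP i\<in>I. f i y)"
      by (rule cSUP_upper[OF i bdd[OF that(2)]])
    finally show "f i x \<le> (SUP i\<in>I. f i y) + c * dist x y" by simp
  qed
  fix x y assume "x \<in> S" "y \<in> S"
  then show "dist (SUP i\<in>I. f i x) (SUP i\<in>I. f i y) \<le> c * dist x y"
    using le[of x y] le[of y x] by (auto simp: dist_real_def abs_minus_commute)
qed

text \<open>At the origin a tent of radius \<open>r\<close> has value \<open>- 3/8 * r\<close>, so
  radius \<open>0\<close> turns the supremum there into a maximum, equal to
  \<open>0\<close>.\<close>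

definition tent_radii :: "real \<Rightarrow> real set" where
  "tent_radii h = insert 0 (range (\<lambda>n. h / 8 ^ n))"

text \<open>The peak height \<open>r / 8\<close> is the next smaller radius; from \<open>r\<close>
  inwards to \<open>r / 2\<close> the tent descends from \<open>r / 8\<close> to
  \<open>- r / 8\<close>.\<close>

definition tents :: "real \<Rightarrow> real \<Rightarrow> real" where
  "tents h x = (SUP r\<in>tent_radii h. r / 8 - \<bar>\<bar>x\<bar> - r\<bar> / 2)"

context
  fixes h :: real
  assumes h: "0 < h"
begin

lemma tent_radii_bounds: "r \<in> tent_radii h \<Longrightarrow> 0 \<le> r \<and> r \<le> h"
  using h by (auto simp: tent_radii_def divide_simps)

lemma tents_lipschitz: "(1/2)-lipschitz_on UNIV (tents h)"
proof -
  have "(1/2)-lipschitz_on UNIV (\<lambda>x. r / 8 - \<bar>\<bar>x\<bar> - r\<bar> / 2)" for r :: real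
  proof (rule lipschitz_onI)
    fix x y :: real
    have "\<bar>\<bar>\<bar>x\<bar> - r\<bar> - \<bar>\<bar>y\<bar> - r\<bar>\<bar> \<le> \<bar>x - y\<bar>"
      using abs_triangle_ineq3[of "\<bar>x\<bar> - r" "\<bar>y\<bar> - r"] abs_triangle_ineq3[of x y] by simp
    then show "dist (r / 8 - \<bar>\<bar>x\<bar> - r\<bar> / 2) (r / 8 - \<bar>\<bar>y\<bar> - r\<bar> / 2) \<le> 1/2 * dist x y"
      unfolding dist_real_def by argo
  qed simp
  moreover have "bdd_above ((\<lambda>r. r / 8 - \<bar>\<bar>x\<bar> - r\<bar> / 2) ` tent_radii h)" for x
  proof (rule bdd_aboveI2[where M = "h / 8"])
    fix r assume "r \<in> tent_radii h"
    from tent_radii_bounds[OF this] show "r / 8 - \<bar>\<bar>x\<bar> - r\<bar> / 2 \<le> h / 8" by argo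
  qed
  ultimately show ?thesis
    unfolding tents_def by (intro lipschitz_on_cSUP) (auto simp: tent_radii_def)
qed

lemma tents_0: "tents h 0 = 0"
  unfolding tents_def
  by (rule cSup_eq_maximum)
    (auto simp: tent_radii_def image_iff abs_real_def intro!: divide_nonneg_nonneg less_imp_le[OF h])

lemma abs_tents_le: "\<bar>tents h x\<bar> \<le> \<bar>x\<bar> / 2"
  using lipschitz_onD[OF tents_lipschitz, of x 0] by (simp add: tents_0 dist_real_def)

lemma tents_branch:
  assumes "h / 8 ^ n / 2 \<le> \<bar>x\<bar>" "\<bar>x\<bar> \<le> h / 8 ^ n"
  shows "tents h x = (\<bar>x\<bar> - 3/4 * (h / 8 ^ n)) / 2"
proof -
  define r where "r = h / 8 ^ n"
  have r: "0 < r" "r / 2 \<le> \<bar>x\<bar>" "\<bar>x\<bar> \<le> r" using h assms by (auto simp: r_def)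
  show ?thesis
    unfolding tents_def r_def[symmetric]
  proof (rule cSup_eq_maximum)
    show "(\<bar>x\<bar> - 3/4 * r) / 2 \<in> (\<lambda>r. r / 8 - \<bar>\<bar>x\<bar> - r\<bar> / 2) ` tent_radii h"
      by (rule image_eqI[of _ _ r]) (use r in \<open>auto simp: tent_radii_def r_def abs_real_def\<close>)
  next
    fix t assume "t \<in> (\<lambda>r. r / 8 - \<bar>\<bar>x\<bar> - r\<bar> / 2) ` tent_radii h"
    then obtain q where q: "q \<in> tent_radii h" and t: "t = q / 8 - \<bar>\<bar>x\<bar> - q\<bar> / 2" by blast
    \<comment> \<open>The ratio \<open>8\<close> leaves no radius strictly between
      \<open>r / 8\<close> and \<open>r\<close>.\<close>
    have "r \<le> q \<or> 0 \<le> q \<and> q \<le> r / 8"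
    proof (cases "q = 0")
      case False
      then obtain k where k: "q = h / 8 ^ k" using q by (auto simp: tent_radii_def)
      show ?thesis
      proof (cases "k \<le> n")
        case True
        then have "(8::real) ^ k \<le> 8 ^ n" by (simp add: power_increasing)
        then show ?thesis using h by (simp add: k r_def frac_le)
      next
        case False
        then have "(8::real) ^ Suc n \<le> 8 ^ k" by (intro power_increasing) auto
        then have "h / 8 ^ k \<le> h / 8 ^ Suc n" using h by (intro frac_le) auto
        then show ?thesis using h by (simp add: k r_def)
      qed
    qed (use r in auto)
    \<comment> \<open>For \<open>q \<ge> r\<close> use
      \<open>t \<le> \<bar>x\<bar> / 2 - 3/8 * q\<close>. For \<open>q \<le> r / 8\<close> use
      \<open>t \<le> 5/8 * q - \<bar>x\<bar> / 2\<close>; this suffices since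
      \<open>\<bar>x\<bar> \<ge> r / 2 \<ge> 29/64 * r\<close>.\<close>
    then show "t \<le> (\<bar>x\<bar> - 3/4 * r) / 2" unfolding t
      using r abs_ge_self[of "\<bar>x\<bar> - q"] abs_ge_minus_self[of "\<bar>x\<bar> - q"] by argo
  qed
qed

end

text \<open>This is \<open>z\<^sub>n\<close>, obtained by unrolling its recursion into a
  series.\<close>

definition branch_code :: "(nat \<Rightarrow> real) \<Rightarrow> nat \<Rightarrow> real" where
  "branch_code s n = 3/4 * (\<Sum>k. (\<Prod>i\<le>k. s (n + i)) / 4 ^ k)"

context
  fixes s :: "nat \<Rightarrow> real"
  assumes s: "\<And>n. \<bar>s n\<bar> \<le> 1"
begin

lemma abs_branch_code_term: "\<bar>(\<Prod>i\<le>k. s (n + i)) / 4 ^ k\<bar> \<le> (1/4) ^ k"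
  using prod_mono[of "{..k}" "\<lambda>i. \<bar>s (n + i)\<bar>" "\<lambda>_. 1"] s
  by (simp add: abs_prod power_one_over divide_right_mono)

lemma summable_branch_code: "summable (\<lambda>k. (\<Prod>i\<le>k. s (n + i)) / 4 ^ k)"
  by (rule summable_comparison_test'[of "\<lambda>k. (1/4) ^ k" 0])
    (use abs_branch_code_term in \<open>auto intro: summable_geometric\<close>)

lemma abs_branch_code_le: "\<bar>branch_code s n\<bar> \<le> 1"
proof -
  have "\<bar>\<Sum>k. (\<Prod>i\<le>k. s (n + i)) / 4 ^ k\<bar> \<le> (\<Sum>k. (1/4 :: real) ^ k)"
    using norm_suminf_le[of "\<lambda>k. (\<Prod>i\<le>k. s (n + i)) / 4 ^ k" "\<lambda>k. (1/4) ^ k"]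
      abs_branch_code_term by (simp add: summable_geometric)
  also have "\<dots> = 4/3" by (subst suminf_geometric) auto
  finally show ?thesis by (simp add: branch_code_def abs_mult)
qed

lemma branch_code_rec: "branch_code s n = s n * (3/4 + branch_code s (Suc n) / 4)"
proof -
  have "(\<Sum>k. (\<Prod>i\<le>k. s (n + i)) / 4 ^ k)
      = s n + (\<Sum>k. (\<Prod>i\<le>Suc k. s (n + i)) / 4 ^ Suc k)"
    using suminf_split_head[OF summable_branch_code[of n]] by simp
  also have "(\<lambda>k. (\<Prod>i\<le>Suc k. s (n + i)) / 4 ^ Suc k)
      = (\<lambda>k. s n / 4 * ((\<Prod>i\<le>k. s (Suc n + i)) / 4 ^ k))"
    by (simp add: prod.atMost_Suc_shift del: prod.atMost_Suc)
  also have "(\<Sum>k. \<dots> k) = s n / 4 * (\<Sum>k. (\<Prod>i\<le>k. s (Suc n + i)) / 4 ^ k)"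
    by (rule suminf_mult[OF summable_branch_code])
  finally show ?thesis by (simp add: branch_code_def algebra_simps)
qed

lemma sgn_branch_code: "sgn (branch_code s n) = sgn (s n)"
proof -
  have "0 < 3/4 + branch_code s (Suc n) / 4" using abs_branch_code_le[of "Suc n"] by linarith
  then show ?thesis by (subst branch_code_rec) (simp add: sgn_mult)
qed

text \<open>For a nonzero sign,
  \<open>\<bar>z\<^sub>n\<bar> = 3/4 + z\<^sub>n\<^sub>+\<^sub>1 / 4\<close> lies between
  \<open>1/2\<close> and \<open>1\<close>, so \<open>tents_branch\<close> applies. For sign
  \<open>0\<close>, absorption makes both codes vanish.\<close>

lemma tents_branch_code:
  assumes "0 < h" and sn: "s n \<in> {-1, 0, 1}" and absorb: "s n = 0 \<Longrightarrow> s (Suc n) = 0"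
  shows "tents h (h / 8 ^ n * branch_code s n) = h / 8 ^ Suc n * branch_code s (Suc n)"
proof (cases "s n = 0")
  case True
  then show ?thesis
    using absorb by (simp add: branch_code_rec[of n] branch_code_rec[of "Suc n"] tents_0[OF \<open>0 < h\<close>])
next
  case False
  define r where "r = h / 8 ^ n"
  have r: "0 < r" using \<open>0 < h\<close> by (simp add: r_def)
  have abs: "\<bar>branch_code s n\<bar> = 3/4 + branch_code s (Suc n) / 4"
    using False sn abs_branch_code_le[of "Suc n"] by (subst branch_code_rec) (auto simp: abs_mult)
  have "1/2 \<le> \<bar>branch_code s n\<bar>" using abs_branch_code_le[of "Suc n"] by (simp add: abs)
  then have "r / 2 \<le> \<bar>r * branch_code s n\<bar>" "\<bar>r * branch_code s n\<bar> \<le> r"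
    using r abs_branch_code_le[of n] mult_left_mono[of "1/2" "\<bar>branch_code s n\<bar>" r]
    by (auto simp: abs_mult)
  then have "tents h (r * branch_code s n) = (\<bar>r * branch_code s n\<bar> - 3/4 * r) / 2"
    using tents_branch[OF \<open>0 < h\<close>, of n] by (simp add: r_def)
  also have "\<dots> = r * branch_code s (Suc n) / 8"
    using r by (simp add: abs_mult abs algebra_simps)
  finally show ?thesis by (simp add: r_def)
qed

end

text \<open>Of two orbit points, the earlier is strictly farther from \<open>p\<close> unless both
  equal \<open>p\<close>, so its side of \<open>p\<close> decides the comparison.\<close>

lemma contraction_orbit_less_iff:
  fixes f :: "real \<Rightarrow> real"
  assumes f: "f \<in> contraction_maps I" and p: "p \<in> I" "f p = p" and x: "x \<in> I"
  shows "(f ^^ m) x < (f ^^ n) x \<longleftrightarrow>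
    m < n \<and> sgn ((f ^^ m) x - p) = -1 \<or> n < m \<and> sgn ((f ^^ n) x - p) = 1"
proof -
  define u where "u n = (f ^^ n) x - p" for n
  obtain c where c: "c < 1" "c-lipschitz_on I f" and fI: "f \<in> I \<rightarrow> I"
    using f by (auto simp: contraction_maps_def)
  have orbit: "(f ^^ n) x \<in> I" for n by (induction n) (use x fI in auto)
  have step: "\<bar>u (Suc n)\<bar> \<le> c * \<bar>u n\<bar>" for n
    using lipschitz_onD[OF c(2) orbit[of n] p(1)] by (simp add: u_def p dist_real_def)
  have decr: "\<bar>u (Suc n)\<bar> \<le> \<bar>u n\<bar>" for n
    using step[of n] mult_right_mono[of c 1 "\<bar>u n\<bar>"] c by simp
  have strict: "\<bar>u (Suc n)\<bar> < \<bar>u n\<bar>" if "u n \<noteq> 0" for n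
    using step[of n] mult_strict_right_mono[of c 1 "\<bar>u n\<bar>"] c that by linarith
  \<comment> \<open>The strict drop occurs from \<open>m\<close> to \<open>Suc m\<close>; from there
    to \<open>n\<close> monotonicity is enough.\<close>
  have later: "\<bar>u n\<bar> < \<bar>u m\<bar> \<or> u m = 0 \<and> u n = 0" if "m < n" for m n
    using lift_Suc_antimono_le[of "\<lambda>n. \<bar>u n\<bar>" "Suc m" n, OF decr] that strict[of m] decr[of m]
    by fastforce
  have "u m < u n \<longleftrightarrow> m < n \<and> sgn (u m) = -1 \<or> n < m \<and> sgn (u n) = 1"
    using later[of m n] later[of n m]
    by (cases m n rule: linorder_cases) (auto simp: sgn_if)
  then show ?thesis by (simp add: u_def)
qed

lemma contraction_fixpoint:
  assumes "g \<in> contraction_maps {a..b}" "a \<le> b"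
  obtains p where "p \<in> {a..b}" "g p = p"
proof -
  obtain c where c: "c < 1" "c-lipschitz_on {a..b} g" and g: "g \<in> {a..b} \<rightarrow> {a..b}"
    using assms by (auto simp: contraction_maps_def)
  have "\<exists>!p\<in>{a..b}. g p = p"
  proof (rule Banach_fix[of _ c])
    show "complete {a..b}" by (simp add: compact_imp_complete)
  qed (use c g assms lipschitz_on_nonneg[OF c(2)] lipschitz_onD[OF c(2)] in auto)
  with that show ?thesis by blast
qed

theorem corollary3p1:
  fixes a b :: real
  assumes "a < b"
  shows "\<exists>f \<in> contraction_maps {a..b}. \<forall>g \<in> contraction_maps {a..b}. \<forall>y \<in> {a..b}.
    \<exists>x \<in> {a..b}. same_order_pattern (\<lambda>n. (f ^^ n) x) (\<lambda>n. (g ^^ n) y)"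
proof -
  define q where "q = (a + b) / 2"
  define h where "h = (b - a) / 2"
  define f where "f x = q + tents h (x - q)" for x
  have h: "0 < h" using assms by (simp add: h_def)
  have I: "x \<in> {a..b} \<longleftrightarrow> \<bar>x - q\<bar> \<le> h" for x
    unfolding q_def h_def abs_le_iff atLeastAtMost_iff by argo
  have fq: "f q = q" by (simp add: f_def tents_0[OF h])
  have "f \<in> {a..b} \<rightarrow> {a..b}"
  proof
    fix x assume "x \<in> {a..b}"
    then show "f x \<in> {a..b}" unfolding I using abs_tents_le[OF h, of "x - q"] by (simp add: f_def)
  qed
  moreover have "(1/2)-lipschitz_on {a..b} f"
    by (rule lipschitz_onI)
      (use lipschitz_onD[OF tents_lipschitz[OF h], of "x - q" "y - q" for x y]
        in \<open>auto simp: f_def dist_real_def\<close>)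
  ultimately have f: "f \<in> contraction_maps {a..b}"
    by (force simp: contraction_maps_def)
  show ?thesis
  proof (intro bexI[OF _ f] ballI)
    fix g y assume g: "g \<in> contraction_maps {a..b}" and y: "y \<in> {a..b}"
    obtain p where p: "p \<in> {a..b}" "g p = p"
      using contraction_fixpoint[OF g] assms by auto
    define s where "s n = sgn ((g ^^ n) y - p)" for n
    have s_cases: "s n \<in> {-1, 0, 1}" for n by (auto simp: s_def sgn_if)
    have s: "\<bar>s n\<bar> \<le> 1" for n using s_cases[of n] by auto
    \<comment> \<open>Sign \<open>0\<close> means that the orbit of \<open>y\<close> has reached the
      fixed point \<open>p\<close>.\<close>
    have absorb: "s (Suc n) = 0" if "s n = 0" for n
      using that p by (simp add: s_def sgn_eq_0_iff)
    define x where "x = q + h * branch_code s 0"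
    have orbit: "(f ^^ n) x = q + h / 8 ^ n * branch_code s n" for n
    proof (induction n)
      case (Suc n)
      then show ?case using tents_branch_code[OF s h s_cases[of n] absorb[of n]] by (simp add: f_def)
    qed (simp add: x_def)
    have x: "x \<in> {a..b}"
      unfolding I using h abs_branch_code_le[OF s, where n = 0] by (simp add: x_def abs_mult)
    have sgns: "sgn ((f ^^ n) x - q) = sgn ((g ^^ n) y - p)" for n
      using h sgn_branch_code[of s n, OF s] by (simp add: orbit sgn_mult) (simp add: s_def)
    have q: "q \<in> {a..b}" unfolding I using h by simp
    \<comment> \<open>Comparisons in both orbits reduce to signs relative to \<open>q\<close> and
      \<open>p\<close>, which agree by \<open>sgns\<close>.\<close>
    have "same_order_pattern (\<lambda>n. (f ^^ n) x) (\<lambda>n. (g ^^ n) y)"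
      unfolding same_order_pattern_def contraction_orbit_less_iff[OF f q fq x]
        contraction_orbit_less_iff[OF g p y] sgns by simp
    with x show "\<exists>x \<in> {a..b}. same_order_pattern (\<lambda>n. (f ^^ n) x) (\<lambda>n. (g ^^ n) y)" by blast
  qed
qed

end
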